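(* Let $S=\mathscr{M}[G;I,\Lambda;P]$ be a completely simple semigroup and let $\gamma_1=(\bar\gamma_1,\lambda_k)$, $\gamma_2=(\bar\gamma_2,\lambda_l)\in T\mathcal{L}(S)$. Then $\gamma_1\,\mathscr{L}\,\gamma_2$ (Green's relation in $T\mathcal{L}(S)$) if and only if $\lambda_k=\lambda_l$.
   Context: $G$ is a group, $I,\Lambda$ are nonempty sets, $P=(p_{\lambda i})$ is a $\Lambda\times I$ matrix over $G$, and $S=\mathscr{M}[G;I,\Lambda;P]=G\times I\times\Lambda$ with product $(a,i,\lambda)(b,j,\mu)=(ap_{\lambda j}b,i,\mu)$. Category $\mathcal{L}(S)$ (composition written left to right): objects are the principal left ideals of $S$, namely $\bar\lambda=G\times I\times\{\lambda\}$, $\lambda\in\Lambda$; the morphisms $\bar\lambda_1\to\bar\lambda_2$ are the (partial) right translations, namely the maps $\rho(g):(h,i,\lambda_1)\mapsto(hg,i,\lambda_2)$, $g\in G$. All morphisms are isomorphisms and the only inclusions are identities. A normal cone $\gamma$ in $\mathcal{L}(S)$ with vertex $\bar\lambda$ is a choice of morphisms $\gamma(\bar\mu):\bar\mu\to\bar\lambda$ for all $\mu\in\Lambda$; it is identified with $(\bar\gamma,\lambda)\in G^\Lambda\times\Lambda$ where $\gamma(\bar\mu)=\rho(\bar\gamma(\mu))$. $T\mathcal{L}(S)$ is the semigroup of all normal cones with product $(\gamma_1\ast\gamma_2)(\bar\mu)=\gamma_1(\bar\mu)\gamma_2(c_{\gamma_1})$, $c_{\gamma_1}$ being the vertex of $\gamma_1$;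 in coordinates $(\bar\gamma_1,\lambda_k)\ast(\bar\gamma_2,\lambda_l)=(\bar\gamma_1\cdot\bar g_k,\lambda_l)$, where $g_k=\bar\gamma_2(\lambda_k)$ and $\bar g_k=(g_k,g_k,\dots)\in G^\Lambda$. *)

theory Defs
  imports "HOL-Algebra.Group"
begin

record 'a magma = "'a partial_object" +
  prod :: "'a \<Rightarrow> 'a \<Rightarrow> 'a"  (infixl \<open>\<cdot>\<index>\<close> 70)

definition principal_left_ideal :: "('a, 'm) magma_scheme \<Rightarrow> 'a \<Rightarrow> 'a set" where
  "principal_left_ideal S x = insert x ((\<lambda>s. s \<cdot>\<^bsub>S\<^esub> x) ` carrier S)"

definition green_L :: "('a, 'm) magma_scheme \<Rightarrow> 'a \<Rightarrow> 'a \<Rightarrow> bool" where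
  "green_L S x y \<longleftrightarrow>
     x \<in> carrier S \<and> y \<in> carrier S \<and> principal_left_ideal S x = principal_left_ideal S y"

definition rees_matrix ::
  "('g, 'm) monoid_scheme \<Rightarrow> 'i set \<Rightarrow> 'l set \<Rightarrow> ('l \<Rightarrow> 'i \<Rightarrow> 'g) \<Rightarrow> ('g \<times> 'i \<times> 'l) magma" where
  "rees_matrix G I \<Lambda> P =
     \<lparr>carrier = carrier G \<times> I \<times> \<Lambda>,
      prod = (\<lambda>(a, i, l) (b, j, m). (a \<otimes>\<^bsub>G\<^esub> P l j \<otimes>\<^bsub>G\<^esub> b, i, m))\<rparr>"

text \<open>The category of principal left ideals, for regular \<open>S\<close>. A morphism from \<open>A\<close> to \<open>B\<close> is a right
  translation of \<open>S\<close> restricted to \<open>A\<close> and mapping into \<open>B\<close>; it is undefined outside \<open>A\<close>.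
  The composite (left to right) of \<open>f\<close> from \<open>A\<close> and \<open>g\<close> is \<open>compose A g f\<close>.\<close>

definition L_objects :: "('a, 'm) magma_scheme \<Rightarrow> 'a set set" where
  "L_objects S = principal_left_ideal S ` carrier S"

definition L_hom :: "('a, 'm) magma_scheme \<Rightarrow> 'a set \<Rightarrow> 'a set \<Rightarrow> ('a \<Rightarrow> 'a) set" where
  "L_hom S A B =
     {\<lambda>x\<in>A. x \<cdot>\<^bsub>S\<^esub> u | u. u \<in> carrier S \<and> (\<forall>x\<in>A. x \<cdot>\<^bsub>S\<^esub> u \<in> B)}"

definition L_iso :: "('a, 'm) magma_scheme \<Rightarrow> 'a set \<Rightarrow> 'a set \<Rightarrow> ('a \<Rightarrow> 'a) set" where
  "L_iso S A B =
     {f \<in> L_hom S A B. \<exists>g \<in> L_hom S B A.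
        compose A g f = (\<lambda>x\<in>A. x) \<and> compose B f g = (\<lambda>x\<in>B. x)}"

record 'a cone =
  component :: "'a set \<Rightarrow> 'a \<Rightarrow> 'a"
  vertex :: "'a set"

text \<open>The second condition is compatibility with inclusions of objects. For a Rees matrix semigroup
  the last two conditions hold automatically; see \<open>normal_cone_rees_matrix_iff\<close> below.\<close>

definition normal_cone :: "('a, 'm) magma_scheme \<Rightarrow> 'a cone \<Rightarrow> bool" where
  "normal_cone S \<gamma> \<longleftrightarrow>
     vertex \<gamma> \<in> L_objects S \<and>
     component \<gamma> \<in> (\<Pi>\<^sub>E A\<in>L_objects S. L_hom S A (vertex \<gamma>)) \<and>
     (\<forall>A\<in>L_objects S. \<forall>B\<in>L_objects S. A \<subseteq> B \<longrightarrow> component \<gamma> A = restrict (component \<gamma> B) A) \<and>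
     (\<exists>A\<in>L_objects S. component \<gamma> A \<in> L_iso S A (vertex \<gamma>))"

text \<open>For a general regular semigroup the product uses the epimorphic part of the component of
  \<open>\<gamma>\<^sub>2\<close>; here all morphisms are isomorphisms, so this is the component itself.\<close>

definition cone_prod :: "('a, 'm) magma_scheme \<Rightarrow> 'a cone \<Rightarrow> 'a cone \<Rightarrow> 'a cone" where
  "cone_prod S \<gamma>\<^sub>1 \<gamma>\<^sub>2 =
     \<lparr>component = (\<lambda>A\<in>L_objects S. compose A (component \<gamma>\<^sub>2 (vertex \<gamma>\<^sub>1)) (component \<gamma>\<^sub>1 A)),
      vertex = vertex \<gamma>\<^sub>2\<rparr>"

definition TL :: "('a, 'm) magma_scheme \<Rightarrow> 'a cone magma" where
  "TL S = \<lparr>carrier = {\<gamma>. normal_cone S \<gamma>}, prod = cone_prod S\<rparr>"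

text \<open>The concrete description for Rees matrix semigroups: \<open>lbar G I l\<close> is \<open>G \<times> I \<times> {l}\<close> and
  \<open>rho G I l m g\<close> is the morphism \<open>\<rho>(g)\<close> from \<open>lbar G I l\<close> to \<open>lbar G I m\<close>.\<close>

definition lbar :: "('g, 'm) monoid_scheme \<Rightarrow> 'i set \<Rightarrow> 'l \<Rightarrow> ('g \<times> 'i \<times> 'l) set" where
  "lbar G I l = carrier G \<times> I \<times> {l}"

definition rho ::
  "('g, 'm) monoid_scheme \<Rightarrow> 'i set \<Rightarrow> 'l \<Rightarrow> 'l \<Rightarrow> 'g \<Rightarrow> 'g \<times> 'i \<times> 'l \<Rightarrow> 'g \<times> 'i \<times> 'l" where
  "rho G I l m g = (\<lambda>(h, i, _)\<in>lbar G I l. (h \<otimes>\<^bsub>G\<^esub> g, i, m))"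

text \<open>The normal cone with coordinates \<open>(c, l)\<close>: its component at \<open>lbar G I m\<close> is
  \<open>rho G I m l (c m)\<close>. The index \<open>m\<close> is recovered from the object, using that \<open>lbar G I\<close> is
  injective.\<close>

definition coord_cone ::
  "('g, 'm) monoid_scheme \<Rightarrow> 'i set \<Rightarrow> 'l set \<Rightarrow> ('l \<Rightarrow> 'g) \<Rightarrow> 'l \<Rightarrow> ('g \<times> 'i \<times> 'l) cone" where
  "coord_cone G I \<Lambda> c l =
     \<lparr>component = (\<lambda>A\<in>lbar G I ` \<Lambda>. let m = the_inv_into \<Lambda> (lbar G I) A in rho G I m l (c m)),
      vertex = lbar G I l\<rparr>"

locale rees_matrix_data = group G for G (structure) +
  fixes I :: "'i set" and \<Lambda> :: "'l set" and P :: "'l \<Rightarrow> 'i \<Rightarrow> 'a"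
  assumes I_nonempty: "I \<noteq> {}" and Lambda_nonempty: "\<Lambda> \<noteq> {}"
    and P_closed: "P \<in> \<Lambda> \<rightarrow> I \<rightarrow> carrier G"
begin

abbreviation "S \<equiv> rees_matrix G I \<Lambda> P"
abbreviation "bar \<equiv> lbar G I"
abbreviation "r \<equiv> rho G I"

lemma P_in [simp]: "l \<in> \<Lambda> \<Longrightarrow> i \<in> I \<Longrightarrow> P l i \<in> carrier G"
  using P_closed by auto

lemma carrier_S: "carrier S = carrier G \<times> I \<times> \<Lambda>"
  by (simp add: rees_matrix_def)

lemma prod_S [simp]: "(a, i, l) \<cdot>\<^bsub>S\<^esub> (b, j, m) = (a \<otimes> P l j \<otimes> b, i, m)"
  by (simp add: rees_matrix_def)

lemma bar_inject: "bar l = bar m \<longleftrightarrow> l = m"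
  using I_nonempty one_closed by (auto simp: lbar_def)

lemma bar_subset_iff: "bar l \<subseteq> bar m \<longleftrightarrow> l = m"
  using I_nonempty one_closed by (auto simp: lbar_def)

lemma inj_on_bar: "inj_on bar \<Lambda>"
  by (simp add: inj_on_def bar_inject)

lemma principal_left_ideal_S:
  assumes "a \<in> carrier G" "i \<in> I" "l \<in> \<Lambda>"
  shows "principal_left_ideal S (a, i, l) = bar l"
proof -
  have "(h, j, l) \<in> (\<lambda>s. s \<cdot>\<^bsub>S\<^esub> (a, i, l)) ` carrier S" if "h \<in> carrier G" "j \<in> I" for h j
  proof (rule image_eqI)
    let ?q = "P l i \<otimes> a"
    have "?q \<in> carrier G" using assms by simp
    then show "(h, j, l) = (h \<otimes> inv ?q, j, l) \<cdot>\<^bsub>S\<^esub> (a, i, l)"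
      using that assms by (simp add: m_assoc)
    show "(h \<otimes> inv ?q, j, l) \<in> carrier S"
      using that assms by (simp add: carrier_S)
  qed
  then show ?thesis
    using assms by (auto simp: principal_left_ideal_def lbar_def carrier_S)
qed

lemma L_objects_S: "L_objects S = bar ` \<Lambda>"
proof -
  obtain i where "i \<in> I" using I_nonempty by auto
  then have "bar l \<in> L_objects S" if "l \<in> \<Lambda>" for l
    using that principal_left_ideal_S[of \<one> i l]
    by (auto simp: L_objects_def carrier_S intro!: image_eqI[where x="(\<one>, i, l)"])
  then show ?thesis
    by (auto simp: L_objects_def carrier_S principal_left_ideal_S)
qed

lemma L_hom_S:
  assumes "l \<in> \<Lambda>" "m \<in> \<Lambda>"
  shows "L_hom S (bar l) (bar m) = r l m ` carrier G"
proof (intro subset_antisym subsetI)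
  fix f assume "f \<in> L_hom S (bar l) (bar m)"
  then obtain b j n where u: "b \<in> carrier G" "j \<in> I" "n \<in> \<Lambda>"
    and f: "f = (\<lambda>x\<in>bar l. x \<cdot>\<^bsub>S\<^esub> (b, j, n))"
    and B: "\<forall>x\<in>bar l. x \<cdot>\<^bsub>S\<^esub> (b, j, n) \<in> bar m"
    by (auto simp: L_hom_def carrier_S)
  have "n = m"
    using B u(2) by (force simp: lbar_def)
  then have "f = r l m (P l j \<otimes> b)"
    using u assms by (auto simp: f rho_def lbar_def restrict_def fun_eq_iff m_assoc)
  then show "f \<in> r l m ` carrier G" using u assms by auto
next
  fix f assume "f \<in> r l m ` carrier G"
  then obtain g where g: "g \<in> carrier G" "f = r l m g" by auto
  obtain j where j: "j \<in> I" using I_nonempty by auto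
  let ?u = "(inv (P l j) \<otimes> g, j, m)"
  have "h \<otimes> P l j \<otimes> (inv (P l j) \<otimes> g) = h \<otimes> g" if "h \<in> carrier G" for h
    using that g j assms by (simp add: m_assoc[symmetric]) (simp add: m_assoc)
  then have "f = (\<lambda>x\<in>bar l. x \<cdot>\<^bsub>S\<^esub> ?u)" "\<forall>x\<in>bar l. x \<cdot>\<^bsub>S\<^esub> ?u \<in> bar m"
    using g j assms by (auto simp: rho_def lbar_def restrict_def fun_eq_iff)
  moreover have "?u \<in> carrier S" using g j assms by (simp add: carrier_S)
  ultimately show "f \<in> L_hom S (bar l) (bar m)" unfolding L_hom_def by blast
qed

lemma rho_inject:
  assumes "g \<in> carrier G" "h \<in> carrier G" "r l m g = r l m h"
  shows "g = h"
proof -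
  obtain i where "i \<in> I" using I_nonempty by auto
  with fun_cong[OF assms(3), of "(\<one>, i, l)"] assms(1,2) show ?thesis
    by (simp add: rho_def lbar_def)
qed

lemma compose_rho:
  assumes "g \<in> carrier G" "h \<in> carrier G"
  shows "compose (bar l) (r m n h) (r l m g) = r l n (g \<otimes> h)"
  using assms by (auto simp: compose_def rho_def lbar_def restrict_def fun_eq_iff m_assoc)

lemma rho_one: "r l l \<one> = (\<lambda>x\<in>bar l. x)"
  by (auto simp: rho_def lbar_def restrict_def fun_eq_iff)

lemma L_iso_S:
  assumes "l \<in> \<Lambda>" "m \<in> \<Lambda>"
  shows "L_iso S (bar l) (bar m) = L_hom S (bar l) (bar m)"
proof -
  have "\<exists>f \<in> L_hom S (bar m) (bar l). compose (bar l) f (r l m g) = (\<lambda>x\<in>bar l. x) \<and>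
      compose (bar m) (r l m g) f = (\<lambda>x\<in>bar m. x)" if "g \<in> carrier G" for g
    using that assms by (intro bexI[of _ "r m l (inv g)"])
      (simp_all add: compose_rho rho_one L_hom_S)
  then show ?thesis using assms by (auto simp: L_iso_def L_hom_S)
qed

lemma normal_cone_rees_matrix_iff:
  "normal_cone S \<gamma> \<longleftrightarrow>
     vertex \<gamma> \<in> L_objects S \<and> component \<gamma> \<in> (\<Pi>\<^sub>E A\<in>L_objects S. L_hom S A (vertex \<gamma>))"
  (is "_ \<longleftrightarrow> ?v \<and> ?c")
proof -
  have "(\<forall>A\<in>L_objects S. \<forall>B\<in>L_objects S. A \<subseteq> B \<longrightarrow> component \<gamma> A = restrict (component \<gamma> B) A) \<and>
     (\<exists>A\<in>L_objects S. component \<gamma> A \<in> L_iso S A (vertex \<gamma>))" if "?v" "?c"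
  proof (intro conjI ballI impI)
    fix A B assume "A \<in> L_objects S" "B \<in> L_objects S" "A \<subseteq> B"
    then have "A = B" by (auto simp: L_objects_S bar_subset_iff)
    moreover have "component \<gamma> B \<in> L_hom S B (vertex \<gamma>)"
      using that \<open>B \<in> L_objects S\<close> by auto
    then have "component \<gamma> B \<in> extensional B" by (auto simp: L_hom_def)
    ultimately show "component \<gamma> A = restrict (component \<gamma> B) A"
      by (simp add: extensional_restrict)
  next
    obtain l where "l \<in> \<Lambda>" using Lambda_nonempty by auto
    then show "\<exists>A\<in>L_objects S. component \<gamma> A \<in> L_iso S A (vertex \<gamma>)"
      using that L_iso_S by (intro bexI[of _ "bar l"]) (auto simp: L_objects_S)
  qed
  then show ?thesis unfolding normal_cone_def by blast
qed

lemma component_coord_cone: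
  "m \<in> \<Lambda> \<Longrightarrow> component (coord_cone G I \<Lambda> c l) (bar m) = r m l (c m)"
  by (simp add: coord_cone_def the_inv_into_f_f[OF inj_on_bar])

lemma vertex_coord_cone: "vertex (coord_cone G I \<Lambda> c l) = bar l"
  by (simp add: coord_cone_def)

lemma coord_cone_eqI:
  assumes "component \<gamma> \<in> extensional (bar ` \<Lambda>)" "vertex \<gamma> = bar l"
    and "\<And>m. m \<in> \<Lambda> \<Longrightarrow> component \<gamma> (bar m) = r m l (c m)"
  shows "\<gamma> = coord_cone G I \<Lambda> c l"
proof -
  have "component \<gamma> = component (coord_cone G I \<Lambda> c l)"
  proof (rule extensionalityI[OF assms(1)])
    show "component (coord_cone G I \<Lambda> c l) \<in> extensional (bar ` \<Lambda>)" by (simp add: coord_cone_def)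
  qed (auto simp: assms(3) component_coord_cone)
  then show ?thesis by (intro cone.equality) (simp_all add: assms(2) vertex_coord_cone)
qed

text \<open>The identification of normal cones with pairs in \<open>G\<^sup>\<Lambda> \<times> \<Lambda>\<close>, and the product in coordinates.\<close>

lemma bij_betw_coord_cone:
  "bij_betw (\<lambda>(c, l). coord_cone G I \<Lambda> c l) ((\<Lambda> \<rightarrow>\<^sub>E carrier G) \<times> \<Lambda>) (carrier (TL S))"
proof (rule bij_betwI')
  fix x y assume xy: "x \<in> (\<Lambda> \<rightarrow>\<^sub>E carrier G) \<times> \<Lambda>" "y \<in> (\<Lambda> \<rightarrow>\<^sub>E carrier G) \<times> \<Lambda>"
  obtain c l d k where [simp]: "x = (c, l)" "y = (d, k)" by (cases x, cases y)
  have "c = d \<and> l = k" if eq: "coord_cone G I \<Lambda> c l = coord_cone G I \<Lambda> d k"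
  proof
    show lk: "l = k" using arg_cong[OF eq, of vertex] by (simp add: vertex_coord_cone bar_inject)
    have "c m = d m" if "m \<in> \<Lambda>" for m
      using xy that fun_cong[OF arg_cong[OF eq, of component], of "bar m"] lk
      by (auto simp: component_coord_cone intro: rho_inject[of _ _ m k])
    then show "c = d" using xy by (auto intro: PiE_ext)
  qed
  then show "((\<lambda>(c, l). coord_cone G I \<Lambda> c l) x = (\<lambda>(c, l). coord_cone G I \<Lambda> c l) y) = (x = y)"
    by auto
next
  fix x assume "x \<in> (\<Lambda> \<rightarrow>\<^sub>E carrier G) \<times> \<Lambda>"
  then show "(\<lambda>(c, l). coord_cone G I \<Lambda> c l) x \<in> carrier (TL S)"
    by (auto simp: TL_def normal_cone_rees_matrix_iff L_objects_S vertex_coord_cone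
        component_coord_cone L_hom_S) (auto simp: coord_cone_def)
next
  fix \<gamma> assume "\<gamma> \<in> carrier (TL S)"
  then have v: "vertex \<gamma> \<in> bar ` \<Lambda>"
    and c: "component \<gamma> \<in> (\<Pi>\<^sub>E A\<in>bar ` \<Lambda>. L_hom S A (vertex \<gamma>))"
    by (auto simp: TL_def normal_cone_rees_matrix_iff L_objects_S)
  then obtain l where l: "l \<in> \<Lambda>" "vertex \<gamma> = bar l" by auto
  have "\<forall>m\<in>\<Lambda>. \<exists>g\<in>carrier G. component \<gamma> (bar m) = r m l g"
  proof
    fix m assume m: "m \<in> \<Lambda>"
    then have "component \<gamma> (bar m) \<in> L_hom S (bar m) (bar l)"
      using c l PiE_mem by fastforce
    then show "\<exists>g\<in>carrier G. component \<gamma> (bar m) = r m l g"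
      using m l by (auto simp: L_hom_S)
  qed
  then obtain d where d: "\<And>m. m \<in> \<Lambda> \<Longrightarrow> d m \<in> carrier G \<and> component \<gamma> (bar m) = r m l (d m)"
    by metis
  have "\<gamma> = coord_cone G I \<Lambda> (restrict d \<Lambda>) l"
    using c l d by (intro coord_cone_eqI) (auto simp: PiE_def)
  moreover have "(restrict d \<Lambda>, l) \<in> (\<Lambda> \<rightarrow>\<^sub>E carrier G) \<times> \<Lambda>" using d l by auto
  ultimately show "\<exists>x\<in>(\<Lambda> \<rightarrow>\<^sub>E carrier G) \<times> \<Lambda>. \<gamma> = (\<lambda>(c, l). coord_cone G I \<Lambda> c l) x"
    by force
qed

lemma coord_cone_prod:
  assumes "c \<in> \<Lambda> \<rightarrow>\<^sub>E carrier G" "k \<in> \<Lambda>" "d \<in> \<Lambda> \<rightarrow>\<^sub>E carrier G" "l \<in> \<Lambda>"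
  shows "coord_cone G I \<Lambda> c k \<cdot>\<^bsub>TL S\<^esub> coord_cone G I \<Lambda> d l =
    coord_cone G I \<Lambda> (\<lambda>m\<in>\<Lambda>. c m \<otimes> d k) l"
  using assms by (intro coord_cone_eqI)
    (auto simp: TL_def cone_prod_def L_objects_S component_coord_cone vertex_coord_cone
      intro!: compose_rho)

end

end

theory Submission
  imports Defs
begin

text \<open>Since \<open>G\<close> is a group, the equation \<open>c m \<otimes> d l = e m\<close> is solvable for \<open>c\<close>, so the left multiples
  of \<open>(d, l)\<close> are exactly the cones with the same vertex \<open>l\<close>. Hence the principal left ideals of the
  cone semigroup are determined by, and determine, the vertex.\<close>

context rees_matrix_data
begin

lemma coord_cone_in_carrier:
  "c \<in> \<Lambda> \<rightarrow>\<^sub>E carrier G \<Longrightarrow> l \<in> \<Lambda> \<Longrightarrow> coord_cone G I \<Lambda> c l \<in> carrier (TL S)"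
  using bspec[OF bij_betwE[OF bij_betw_coord_cone], of "(c, l)"] by simp

text \<open>Surjectivity of \<open>bij_betw_coord_cone\<close>, packaged as an elimination rule so
  that arbitrary cones can be multiplied in coordinates.\<close>

lemma carrier_TL_cases:
  assumes "\<gamma> \<in> carrier (TL S)"
  obtains c l where "c \<in> \<Lambda> \<rightarrow>\<^sub>E carrier G" "l \<in> \<Lambda>" "\<gamma> = coord_cone G I \<Lambda> c l"
proof -
  have "\<gamma> \<in> (\<lambda>(c, l). coord_cone G I \<Lambda> c l) ` ((\<Lambda> \<rightarrow>\<^sub>E carrier G) \<times> \<Lambda>)"
    using assms by (simp only: bij_betw_imp_surj_on[OF bij_betw_coord_cone])
  then show thesis by (elim imageE SigmaE) (simp add: that)
qed

text \<open>A product takes its vertex from the right factor, and right translation by a fixed group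
  element permutes the carrier of \<open>G\<close>. So \<open>d\<close> drops out of the right-hand
  side and only \<open>l\<close> remains.\<close>

lemma principal_left_ideal_coord_cone:
  assumes d: "d \<in> \<Lambda> \<rightarrow>\<^sub>E carrier G" and l: "l \<in> \<Lambda>"
  shows "principal_left_ideal (TL S) (coord_cone G I \<Lambda> d l) =
    (\<lambda>c. coord_cone G I \<Lambda> c l) ` (\<Lambda> \<rightarrow>\<^sub>E carrier G)" (is "?L = ?R")
proof (intro subset_antisym subsetI)
  fix \<gamma> assume "\<gamma> \<in> ?L"
  then consider "\<gamma> = coord_cone G I \<Lambda> d l"
    | \<delta> where "\<delta> \<in> carrier (TL S)" "\<gamma> = \<delta> \<cdot>\<^bsub>TL S\<^esub> coord_cone G I \<Lambda> d l"
    by (auto simp: principal_left_ideal_def)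
  then show "\<gamma> \<in> ?R"
  proof cases
    case 1
    then show ?thesis using d by simp
  next
    case 2
    from 2(1) obtain c k where c: "c \<in> \<Lambda> \<rightarrow>\<^sub>E carrier G" "k \<in> \<Lambda>" "\<delta> = coord_cone G I \<Lambda> c k"
      by (rule carrier_TL_cases)
    \<comment> \<open>Of the right factor only its component at the vertex \<open>k\<close> of the
      left factor enters: every \<open>c m\<close> is multiplied by the same element
      \<open>d k\<close>.\<close>
    have "(\<lambda>m\<in>\<Lambda>. c m \<otimes> d k) \<in> \<Lambda> \<rightarrow>\<^sub>E carrier G"
      using c(1,2) d by (auto simp: PiE_iff)
    then show ?thesis
      unfolding 2(2) c(3) coord_cone_prod[OF c(1,2) d l] by (rule imageI)
  qed
next
  fix \<gamma> assume "\<gamma> \<in> ?R"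
  then obtain e where e: "e \<in> \<Lambda> \<rightarrow>\<^sub>E carrier G" "\<gamma> = coord_cone G I \<Lambda> e l" by auto
  \<comment> \<open>Solves \<open>c m \<otimes> d l = e m\<close> pointwise. The left factor is also
    given the vertex \<open>l\<close>, so the multiplier is \<open>d l\<close>; any other vertex
    \<open>k\<close> in the index set would serve with \<open>d k\<close> instead.\<close>
  let ?c = "\<lambda>m\<in>\<Lambda>. e m \<otimes> inv (d l)"
  have dl: "d l \<in> carrier G" using d l by auto
  have c: "?c \<in> \<Lambda> \<rightarrow>\<^sub>E carrier G" using e(1) dl by (auto simp: PiE_iff)
  have "(\<lambda>m\<in>\<Lambda>. ?c m \<otimes> d l) = e"
  proof (rule extensionalityI)
    show "e \<in> extensional \<Lambda>" using e(1) by (simp add: PiE_def)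
    show "(\<lambda>m\<in>\<Lambda>. ?c m \<otimes> d l) m = e m" if "m \<in> \<Lambda>" for m
      using that PiE_mem[OF e(1) that] dl by (simp add: m_assoc)
  qed simp
  then have "\<gamma> = coord_cone G I \<Lambda> ?c l \<cdot>\<^bsub>TL S\<^esub> coord_cone G I \<Lambda> d l"
    by (simp only: e(2) coord_cone_prod[OF c l d l])
  then show "\<gamma> \<in> ?L"
    using coord_cone_in_carrier[OF c l] by (auto simp: principal_left_ideal_def)
qed

end

theorem proposition19:
  fixes G :: "('g, 'm) monoid_scheme" and I :: "'i set" and \<Lambda> :: "'l set"
    and P :: "'l \<Rightarrow> 'i \<Rightarrow> 'g" and c\<^sub>1 c\<^sub>2 :: "'l \<Rightarrow> 'g" and l\<^sub>k l\<^sub>l :: 'l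
    and \<gamma>\<^sub>1 \<gamma>\<^sub>2 :: "('g \<times> 'i \<times> 'l) cone"
  assumes "group G" and "I \<noteq> {}" and "\<Lambda> \<noteq> {}" and "P \<in> \<Lambda> \<rightarrow> I \<rightarrow> carrier G"
    and "c\<^sub>1 \<in> \<Lambda> \<rightarrow>\<^sub>E carrier G" and "l\<^sub>k \<in> \<Lambda>" and "\<gamma>\<^sub>1 = coord_cone G I \<Lambda> c\<^sub>1 l\<^sub>k"
    and "c\<^sub>2 \<in> \<Lambda> \<rightarrow>\<^sub>E carrier G" and "l\<^sub>l \<in> \<Lambda>" and "\<gamma>\<^sub>2 = coord_cone G I \<Lambda> c\<^sub>2 l\<^sub>l"
  shows "green_L (TL (rees_matrix G I \<Lambda> P)) \<gamma>\<^sub>1 \<gamma>\<^sub>2 \<longleftrightarrow> l\<^sub>k = l\<^sub>l"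
proof -
  interpret group G by fact
  interpret rees_matrix_data G I \<Lambda> P
    using assms(2-4) by unfold_locales
  note ideal = principal_left_ideal_coord_cone
  have "l\<^sub>k = l\<^sub>l"
    if "principal_left_ideal (TL S) \<gamma>\<^sub>1 = principal_left_ideal (TL S) \<gamma>\<^sub>2"
  proof -
    \<comment> \<open>A principal left ideal contains its generator by definition, so no identity of
      the cone semigroup is involved.\<close>
    have "\<gamma>\<^sub>1 \<in> principal_left_ideal (TL S) \<gamma>\<^sub>2"
      using that by (auto simp: principal_left_ideal_def)
    then obtain c where "\<gamma>\<^sub>1 = coord_cone G I \<Lambda> c l\<^sub>l"
      using assms(8-10) by (auto simp: ideal)
    \<comment> \<open>The functions \<open>c\<^sub>1\<close> and \<open>c\<close> need not be
      compared: the vertex alone recovers the index, since \<open>lbar G I\<close> is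
      injective.\<close>
    then have "vertex (coord_cone G I \<Lambda> c\<^sub>1 l\<^sub>k) = vertex (coord_cone G I \<Lambda> c l\<^sub>l)"
      using assms(7) by simp
    then show ?thesis by (simp only: vertex_coord_cone bar_inject)
  qed
  \<comment> \<open>After rewriting with \<open>ideal\<close>, both sides are the same set, because
    neither \<open>c\<^sub>1\<close> nor \<open>c\<^sub>2\<close> occurs any more.\<close>
  moreover have "principal_left_ideal (TL S) \<gamma>\<^sub>1 = principal_left_ideal (TL S) \<gamma>\<^sub>2"
    if "l\<^sub>k = l\<^sub>l"
    using that assms(5-10) by (simp only: ideal)
  moreover have "\<gamma>\<^sub>1 \<in> carrier (TL S)" "\<gamma>\<^sub>2 \<in> carrier (TL S)"
    using assms(5-10) by (simp_all only: coord_cone_in_carrier)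
  ultimately show ?thesis by (auto simp only: green_L_def)
qed

end
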